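(* Let $s\ge1$ be an integer and let $p,q\in(0,1)$ be fixed real numbers with $p\neq q$ and $\sum_{k=0}^{s}p^kq^{s-k}=1$. For each integer $n\ge1$ let $X=X_n\sim\mathcal{B}^{(s)}(n,p)$ be a bi$^s$nomial random variable, and set $$\mu_s=E(X)=np\,\frac{(s+1)p^{s}-1}{p-q},\qquad \sigma_s^2=V(X)=npq\,\frac{1-(s+1)^2(pq)^s}{(p-q)^2},\qquad \sigma_s=\sqrt{\sigma_s^2}.$$ Then the standardized variable $Z=\frac{X-\mu_s}{\sigma_s}$ converges in distribution, as $n\to\infty$, to the standard normal distribution $N(0,1)$.
   Context: For integers $n\ge 1$, $s\ge1$, $k\ge0$, the bi$^s$nomial coefficient $\binom{n}{k}_s$ is the number of integer solutions $(x_1,\dots,x_n)$ of $x_1+\cdots+x_n=k$ with $0\le x_i\le s$ for all $i$; equivalently, the coefficient of $x^k$ in $(1+x+\cdots+x^s)^n$. The bi$^s$nomial distribution $\mathcal{B}^{(s)}(n,p)$, where $p,q\in(0,1)$ satisfy $\sum_{k=0}^s p^kq^{s-k}=1$, is the law on $\{0,\dots,sn\}$ with $\mathbb{P}(X=k)=\binom{n}{k}_s p^kq^{sn-k}$. $E$ and $V$ denote expectation and variance. *)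

theory Defs
  imports "HOL-Probability.Probability"
begin

definition bisnomial :: "nat \<Rightarrow> nat \<Rightarrow> nat \<Rightarrow> nat" where
  "bisnomial s n k = card {x \<in> {1..n} \<rightarrow>\<^sub>E {0..s}. (\<Sum>i=1..n. x i) = k}"

(* The coefficient vanishes for k > s * n, so the truncated subtraction in the exponent
   of q is harmless and all the mass lies on {0..s * n}. *)
definition bisnomial_pmf :: "nat \<Rightarrow> nat \<Rightarrow> real \<Rightarrow> real \<Rightarrow> nat pmf" where
  "bisnomial_pmf s n p q = embed_pmf (\<lambda>k. real (bisnomial s n k) * p ^ k * q ^ (s * n - k))"

lemma bisnomial_eq_0:
  assumes "s * n < k"
  shows "bisnomial s n k = 0"
proof -
  have "(\<Sum>i=1..n. x i) \<le> s * n" if "x \<in> {1..n} \<rightarrow>\<^sub>E {0..s}" for x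
    using sum_bounded_above[of "{1..n}" x s] that by (auto simp: PiE_iff mult.commute)
  then have "{x \<in> {1..n} \<rightarrow>\<^sub>E {0..s}. (\<Sum>i=1..n. x i) = k} = {}"
    using assms by (metis (mono_tags, lifting) empty_Collect_eq leD)
  then show ?thesis
    by (simp only: bisnomial_def card.empty)
qed

lemma sum_bisnomial:
  fixes p q :: real
  shows "(\<Sum>k\<le>s * n. real (bisnomial s n k) * p ^ k * q ^ (s * n - k)) =
         (\<Sum>k=0..s. p ^ k * q ^ (s - k)) ^ n"
proof -
  let ?S = "{1..n} \<rightarrow>\<^sub>E {0..s}"
  have fin: "finite ?S"
    by (intro finite_PiE) auto
  have le: "(\<Sum>i=1..n. x i) \<le> s * n" if "x \<in> ?S" for x
    using sum_bounded_above[of "{1..n}" x s] that by (auto simp: PiE_iff mult.commute)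
  have "(\<Sum>k=0..s. p ^ k * q ^ (s - k)) ^ n = (\<Prod>i=1..n. \<Sum>k=0..s. p ^ k * q ^ (s - k))"
    by simp
  also have "\<dots> = (\<Sum>x\<in>?S. \<Prod>i=1..n. p ^ x i * q ^ (s - x i))"
    by (intro prod_sum_PiE) auto
  also have "\<dots> = (\<Sum>x\<in>?S. p ^ (\<Sum>i=1..n. x i) * q ^ (s * n - (\<Sum>i=1..n. x i)))"
  proof (intro sum.cong refl)
    fix x assume x: "x \<in> ?S"
    have "(\<Sum>i=1..n. s - x i) = (\<Sum>i=1..n. s) - (\<Sum>i=1..n. x i)"
      by (intro sum_subtractf_nat) (use x in \<open>auto simp: PiE_iff\<close>)
    then have eq: "(\<Sum>i=1..n. s - x i) = s * n - (\<Sum>i=1..n. x i)"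
      by (simp add: mult.commute)
    show "(\<Prod>i=1..n. p ^ x i * q ^ (s - x i)) =
        p ^ (\<Sum>i=1..n. x i) * q ^ (s * n - (\<Sum>i=1..n. x i))"
      unfolding eq[symmetric] by (simp add: prod.distrib power_sum)
  qed
  also have "\<dots> = (\<Sum>k\<le>s * n. \<Sum>x\<in>{x \<in> ?S. (\<Sum>i=1..n. x i) = k}.
      p ^ (\<Sum>i=1..n. x i) * q ^ (s * n - (\<Sum>i=1..n. x i)))"
    by (rule sum.group[symmetric]) (use fin le in auto)
  also have "\<dots> = (\<Sum>k\<le>s * n. real (bisnomial s n k) * p ^ k * q ^ (s * n - k))"
    by (intro sum.cong refl) (simp add: bisnomial_def)
  finally show ?thesis ..
qed

lemma pmf_bisnomial:
  fixes p q :: real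
  assumes "0 < p" "0 < q" "(\<Sum>k=0..s. p ^ k * q ^ (s - k)) = 1"
  shows "pmf (bisnomial_pmf s n p q) k = real (bisnomial s n k) * p ^ k * q ^ (s * n - k)"
  unfolding bisnomial_pmf_def
proof (rule pmf_embed_pmf)
  let ?f = "\<lambda>k. real (bisnomial s n k) * p ^ k * q ^ (s * n - k)"
  show "0 \<le> ?f k" for k
    using assms by simp
  have "(\<integral>\<^sup>+k. ennreal (?f k) \<partial>count_space UNIV) = (\<Sum>k\<le>s * n. ennreal (?f k))"
    by (rule nn_integral_count_space') (auto simp: bisnomial_eq_0 not_le)
  also have "\<dots> = ennreal (\<Sum>k\<le>s * n. ?f k)"
    using assms by (intro sum_ennreal) simp
  finally show "(\<integral>\<^sup>+k. ennreal (?f k) \<partial>count_space UNIV) = 1"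
    using assms by (simp add: sum_bisnomial)
qed

end

theory Submission
  imports Defs
begin

text \<open>
  The probability generating function of the law with parameter \<open>n\<close> is the \<open>n\<close>-th power of the one
  with parameter \<open>1\<close>. Evaluated on the unit circle, this says that the law is that of a sum of
  \<open>n\<close> independent variables with the law of parameter \<open>1\<close>, so the classical central limit theorem
  applies; differentiated at \<open>1\<close>, it gives the mean and the variance.
\<close>

section \<open>Auxiliary facts on weak convergence, weighted geometric sums and polynomials\<close>

lemma weak_conv_m_cong:
  assumes "eventually (\<lambda>n. M n = N n) sequentially"
  shows "weak_conv_m M L \<longleftrightarrow> weak_conv_m N L"
proof -
  \<comment> \<open>Weak convergence is a pointwise limit of distribution functions, so finitely
    many indices have no influence.\<close>
  have "eventually (\<lambda>n. cdf (M n) x = cdf (N n) x) sequentially" for x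
    using assms by eventually_elim simp
  then have "(\<lambda>n. cdf (M n) x) \<longlonglongrightarrow> cdf L x \<longleftrightarrow> (\<lambda>n. cdf (N n) x) \<longlonglongrightarrow> cdf L x" for x
    by (rule tendsto_cong)
  then show ?thesis
    unfolding weak_conv_m_def weak_conv_def by simp
qed

text \<open>The induction works because passing from \<open>s\<close> to \<open>Suc s\<close>
  multiplies the old terms by \<open>q\<close> and appends a top term. When the geometric sum is 1,
  this gives the mean of one summand.\<close>

lemma sum_index_times_geometric:
  fixes p q :: "'a::comm_ring_1"
  shows "(p - q) * (\<Sum>k\<le>s. of_nat k * (p ^ k * q ^ (s - k))) =
           of_nat (s + 1) * p ^ (s + 1) - p * (\<Sum>k\<le>s. p ^ k * q ^ (s - k))"
proof (induction s)
  case (Suc s)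
  have "(\<Sum>k\<le>s. of_nat k * (p ^ k * q ^ (Suc s - k))) = q * (\<Sum>k\<le>s. of_nat k * (p ^ k * q ^ (s - k)))"
    "(\<Sum>k\<le>s. p ^ k * q ^ (Suc s - k)) = q * (\<Sum>k\<le>s. p ^ k * q ^ (s - k))"
    by (auto simp: sum_distrib_left Suc_diff_le mult_ac intro!: sum.cong)
  then have "(p - q) * (\<Sum>k\<le>Suc s. of_nat k * (p ^ k * q ^ (Suc s - k))) =
      q * ((p - q) * (\<Sum>k\<le>s. of_nat k * (p ^ k * q ^ (s - k))))
      + (p - q) * (of_nat (Suc s) * p ^ Suc s)"
    "(\<Sum>k\<le>Suc s. p ^ k * q ^ (Suc s - k)) = q * (\<Sum>k\<le>s. p ^ k * q ^ (s - k)) + p ^ Suc s"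
    by (simp_all add: algebra_simps)
  then show ?case
    unfolding Suc by (simp add: algebra_simps)
qed (simp add: algebra_simps)

text \<open>Behind the identity is summation by parts: shifting the index replaces the weights by
  \<open>(k - 1)\<^sup>2 - k\<^sup>2 = 1 - 2 * k\<close>, and \<open>q ^ (s + 1)\<close> removes the
  surplus term at \<open>k = 0\<close>. The first-moment sum is kept so that the mean can be
  inserted.\<close>

lemma sum_square_index_times_geometric:
  fixes p q :: "'a::comm_ring_1"
  shows "(p - q) * (\<Sum>k\<le>s. (of_nat k)\<^sup>2 * (p ^ k * q ^ (s - k))) =
           (of_nat s)\<^sup>2 * p ^ (s + 1) - 2 * q * (\<Sum>k\<le>s. of_nat k * (p ^ k * q ^ (s - k)))
           + q * (\<Sum>k\<le>s. p ^ k * q ^ (s - k)) - q ^ (s + 1)"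
proof (induction s)
  case (Suc s)
  have "(\<Sum>k\<le>s. (of_nat k)\<^sup>2 * (p ^ k * q ^ (Suc s - k))) = q * (\<Sum>k\<le>s. (of_nat k)\<^sup>2 * (p ^ k * q ^ (s - k)))"
    "(\<Sum>k\<le>s. of_nat k * (p ^ k * q ^ (Suc s - k))) = q * (\<Sum>k\<le>s. of_nat k * (p ^ k * q ^ (s - k)))"
    "(\<Sum>k\<le>s. p ^ k * q ^ (Suc s - k)) = q * (\<Sum>k\<le>s. p ^ k * q ^ (s - k))"
    by (auto simp: sum_distrib_left Suc_diff_le mult_ac intro!: sum.cong)
  then have "(p - q) * (\<Sum>k\<le>Suc s. (of_nat k)\<^sup>2 * (p ^ k * q ^ (Suc s - k))) =
      q * ((p - q) * (\<Sum>k\<le>s. (of_nat k)\<^sup>2 * (p ^ k * q ^ (s - k))))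
      + (p - q) * ((of_nat (Suc s))\<^sup>2 * p ^ Suc s)"
    "(\<Sum>k\<le>Suc s. of_nat k * (p ^ k * q ^ (Suc s - k))) =
      q * (\<Sum>k\<le>s. of_nat k * (p ^ k * q ^ (s - k))) + of_nat (Suc s) * p ^ Suc s"
    "(\<Sum>k\<le>Suc s. p ^ k * q ^ (Suc s - k)) = q * (\<Sum>k\<le>s. p ^ k * q ^ (s - k)) + p ^ Suc s"
    by (simp_all add: algebra_simps)
  then show ?case
    unfolding Suc by (simp add: algebra_simps power2_eq_square)
qed simp

lemma pderiv_sum: "pderiv (sum f A) = (\<Sum>x\<in>A. pderiv (f x))"
  using higher_pderiv_sum[of 1 f A] by simp

text \<open>Product rule along \<open>g ^ Suc n = g * g ^ n\<close>; the powers of \<open>g\<close>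
  disappear at 1. For a probability generating function these are the mean and the second factorial
  moment of a sum of \<open>n\<close> independent copies.\<close>

lemma poly_pderiv_power_at_1:
  fixes g :: "'a::idom poly"
  assumes "poly g 1 = 1"
  shows "poly (pderiv (g ^ n)) 1 = of_nat n * poly (pderiv g) 1"
    and "poly (pderiv (pderiv (g ^ n))) 1 =
           of_nat n * poly (pderiv (pderiv g)) 1 + of_nat n * (of_nat n - 1) * (poly (pderiv g) 1)\<^sup>2"
proof (induction n)
  case (Suc n)
  {
    case 1
    show ?case using assms Suc by (simp add: pderiv_mult algebra_simps)
  next
    case 2
    show ?case using assms Suc
      by (simp add: pderiv_mult pderiv_add algebra_simps power2_eq_square)
  }
qed simp_all

text \<open>A nonzero polynomial has finitely many roots, but the reals are infinite. This carries
  identities between real generating functions over to the unit circle.\<close>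

lemma complex_poly_eqI_of_real:
  fixes P Q :: "complex poly"
  assumes "\<And>x::real. poly P (of_real x) = poly Q (of_real x)"
  shows "P = Q"
proof (rule ccontr)
  assume "P \<noteq> Q"
  then have "finite {z. poly (P - Q) z = 0}"
    by (intro poly_roots_finite) simp
  moreover have "range complex_of_real \<subseteq> {z. poly (P - Q) z = 0}"
    using assms by auto
  ultimately have "finite (range complex_of_real)"
    by (rule finite_subset[rotated])
  then show False
    by (simp add: finite_image_iff inj_def infinite_UNIV_char_0)
qed

section \<open>The law for fixed parameters and its probability generating function\<close>

locale bisnomial_params =
  fixes s :: nat and p q :: real
  assumes s_pos: "s \<ge> 1" and p_pos: "0 < p" and q_pos: "0 < q" and p_neq_q: "p \<noteq> q"
    and sum_eq_1: "(\<Sum>k=0..s. p ^ k * q ^ (s - k)) = 1"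
begin

abbreviation law :: "nat \<Rightarrow> nat pmf" where
  "law n \<equiv> bisnomial_pmf s n p q"

lemma pmf_law: "pmf (law n) k = real (bisnomial s n k) * p ^ k * q ^ (s * n - k)"
  by (rule pmf_bisnomial) (use p_pos q_pos sum_eq_1 in auto)

lemma set_pmf_law: "set_pmf (law n) \<subseteq> {..s * n}"
  using bisnomial_eq_0[of s n] by (auto simp: set_pmf_iff pmf_law simp flip: not_less)

lemma finite_set_pmf_law: "finite (set_pmf (law n))"
  using set_pmf_law by (rule finite_subset) simp

lemma integrable_law [simp]:
  fixes f :: "nat \<Rightarrow> 'b::{banach, second_countable_topology}"
  shows "integrable (measure_pmf (law n)) f"
  by (rule integrable_measure_pmf_finite[OF finite_set_pmf_law])

lemma expectation_law:
  fixes f :: "nat \<Rightarrow> 'b::{banach, second_countable_topology}"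
  shows "measure_pmf.expectation (law n) f = (\<Sum>k\<le>s * n. pmf (law n) k *\<^sub>R f k)"
  by (rule integral_measure_pmf) (use set_pmf_law in auto)

definition pgf :: "nat \<Rightarrow> real poly" where
  "pgf n = (\<Sum>k\<le>s * n. monom (pmf (law n) k) k)"

text \<open>The factor \<open>x ^ k\<close> is absorbed into \<open>p ^ k\<close>, so this is
  \<open>sum_bisnomial\<close> with \<open>p * x\<close> in place of \<open>p\<close>.\<close>

lemma poly_pgf: "poly (pgf n) x = (\<Sum>k=0..s. (p * x) ^ k * q ^ (s - k)) ^ n"
  using sum_bisnomial[of s n "p * x" q]
  by (simp add: pgf_def poly_sum poly_monom pmf_law power_mult_distrib mult_ac)

lemma pgf_eq_power: "pgf n = pgf 1 ^ n"
  by (simp add: poly_eq_poly_eq_iff[symmetric] fun_eq_iff poly_pgf)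

lemma pgf_1: "pgf 1 = (\<Sum>k\<le>s. monom (p ^ k * q ^ (s - k)) k)"
  by (simp add: poly_eq_poly_eq_iff[symmetric] fun_eq_iff poly_pgf poly_sum poly_monom
      power_mult_distrib mult_ac atLeast0AtMost)

text \<open>Comparing coefficients of the two forms of \<open>pgf 1\<close> avoids counting the
  tuples in \<open>bisnomial s 1 k\<close>.\<close>

lemma pmf_law_1: "k \<le> s \<Longrightarrow> pmf (law 1) k = p ^ k * q ^ (s - k)"
  using arg_cong[OF pgf_1, of "\<lambda>P. coeff P k"]
  by (simp add: pgf_def coeff_sum if_distrib cong: if_cong)

lemma poly_pgf_at_1: "poly (pgf n) 1 = 1"
  by (simp add: poly_pgf sum_eq_1)

lemma expectation_eq_pderiv_pgf: "measure_pmf.expectation (law n) real = poly (pderiv (pgf n)) 1"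
  by (simp add: expectation_law pgf_def pderiv_sum pderiv_monom poly_sum poly_monom mult_ac)

text \<open>Differentiation produces the truncated \<open>k - 1\<close>, which is harmless: at
  \<open>k = 0\<close> the other factor \<open>k\<close> vanishes.\<close>

lemma factorial_moment_eq_pderiv_pgf:
  "measure_pmf.expectation (law n) (\<lambda>k. real k * (real k - 1)) = poly (pderiv (pderiv (pgf n))) 1"
  unfolding expectation_law pgf_def
  by (auto simp: pderiv_sum pderiv_monom poly_sum poly_monom mult_ac of_nat_diff
      intro!: sum.cong)

section \<open>Mean and variance, first for one summand, then for \<open>n\<close>\<close>

definition m :: real where "m = p * (((real s + 1) * p ^ s - 1) / (p - q))"

text \<open>\<open>m\<close> and \<open>v\<close> are the claimed mean and variance with the factor
  \<open>n\<close> removed.\<close>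

definition v :: real where "v = p * q * ((1 - (real s + 1)\<^sup>2 * (p * q) ^ s) / (p - q)\<^sup>2)"

lemma expectation_law_1: "measure_pmf.expectation (law 1) real = m"
proof -
  have "(p - q) * measure_pmf.expectation (law 1) real = p * ((real s + 1) * p ^ s - 1)"
    using sum_index_times_geometric[of p q s] sum_eq_1
    by (simp add: expectation_law pmf_law_1 atLeast0AtMost power_add algebra_simps del: One_nat_def)
  then show ?thesis
    using p_neq_q by (simp add: m_def field_simps)
qed

lemma second_moment_law_1: "measure_pmf.expectation (law 1) (\<lambda>k. (real k)\<^sup>2) = v + m\<^sup>2"
proof -
  define d E2 where "d = p - q" and "E2 = measure_pmf.expectation (law 1) (\<lambda>k. (real k)\<^sup>2)"
  define a b where "a = p ^ s" and "b = q ^ s"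
  have d: "d \<noteq> 0"
    using p_neq_q by (simp add: d_def)
  \<comment> \<open>The normalisation in closed form: \<open>p - q\<close> times the geometric sum
    is \<open>p ^ (s + 1) - q ^ (s + 1)\<close>, and that sum is 1.\<close>
  have geom: "p * a - q * b = p - q"
    using power_diff_sumr2[of p "Suc s" q] sum_eq_1
    by (simp add: a_def b_def atLeast0AtMost lessThan_Suc_atMost mult.commute)
  have E1: "d * m = p * ((real s + 1) * a - 1)"
    using d by (simp add: m_def d_def a_def)
  have E2: "d * E2 = (real s)\<^sup>2 * p * a - 2 * q * m + q - q * b"
    using sum_square_index_times_geometric[of p q s] sum_eq_1 expectation_law_1
    by (simp add: expectation_law pmf_law_1 atLeast0AtMost E2_def d_def a_def b_def power_add
        algebra_simps del: One_nat_def)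
  have V: "d\<^sup>2 * v = p * q * (1 - (real s + 1)\<^sup>2 * (a * b))"
    using d by (simp add: v_def d_def a_def b_def power_mult_distrib)
  \<comment> \<open>With the powers abstracted to \<open>a\<close> and \<open>b\<close> and
    denominators cleared, only a polynomial consequence of the equations above remains.\<close>
  have "d\<^sup>2 * E2 = d\<^sup>2 * v + d\<^sup>2 * m\<^sup>2"
    using E1 E2 V geom d_def by algebra
  with d show ?thesis
    by (simp add: E2_def flip: distrib_left)
qed

text \<open>The sign cannot be read off the formula for \<open>v\<close>. The point 1 has positive
  mass since \<open>s \<ge> 1\<close>, so \<open>m > 0\<close>; the point 0 also has positive mass
  and lies away from the mean.\<close>

lemma v_pos: "v > 0"
proof -
  let ?E = "measure_pmf.expectation (law 1)"
  have w: "pmf (law 1) k > 0" if "k \<le> s" for k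
    using that p_pos q_pos by (simp add: pmf_law_1 del: One_nat_def)
  have "0 < pmf (law 1) 1 * real 1"
    using w[of 1] s_pos by simp
  also have "\<dots> \<le> (\<Sum>k\<le>s * 1. pmf (law 1) k * real k)"
    by (rule member_le_sum) (use s_pos in auto)
  finally have m: "m > 0"
    using expectation_law[of 1 real] expectation_law_1 by simp
  have "0 < pmf (law 1) 0 * (real 0 - m)\<^sup>2"
    using w[of 0] m by simp
  also have "\<dots> \<le> (\<Sum>k\<le>s * 1. pmf (law 1) k * (real k - m)\<^sup>2)"
    by (rule member_le_sum) auto
  also have "\<dots> = measure_pmf.variance (law 1) real"
    by (simp add: expectation_law_1 expectation_law[where f = "\<lambda>k. (real k - m)\<^sup>2"]
        del: One_nat_def)
  also have "\<dots> = v"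
    by (subst measure_pmf.variance_eq)
      (simp_all add: second_moment_law_1 expectation_law_1 del: One_nat_def)
  finally show ?thesis .
qed

lemma mean_law: "measure_pmf.expectation (law n) real = real n * m"
  using poly_pderiv_power_at_1(1)[OF poly_pgf_at_1[of 1], of n] expectation_law_1
  by (simp add: expectation_eq_pderiv_pgf flip: pgf_eq_power del: One_nat_def)

lemma factorial_moment_law:
  "measure_pmf.expectation (law n) (\<lambda>k. real k * (real k - 1)) = 
     measure_pmf.expectation (law n) (\<lambda>k. (real k)\<^sup>2) - real n * m"
proof -
  have "measure_pmf.expectation (law n) (\<lambda>k. real k * (real k - 1)) =
      measure_pmf.expectation (law n) (\<lambda>k. (real k)\<^sup>2 - real k)"
    by (simp add: power2_eq_square algebra_simps)
  then show ?thesis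
    by (simp add: mean_law)
qed

lemma variance_law: "measure_pmf.variance (law n) real = real n * v"
proof -
  \<comment> \<open>Here \<open>v + m\<^sup>2 - m\<close> is the second factorial moment of one
    summand.\<close>
  have "measure_pmf.expectation (law n) (\<lambda>k. (real k)\<^sup>2) - real n * m =
      real n * (v + m\<^sup>2 - m) + real n * (real n - 1) * m\<^sup>2"
    using poly_pderiv_power_at_1(2)[OF poly_pgf_at_1[of 1], of n]
      factorial_moment_law[of n] factorial_moment_law[of 1] second_moment_law_1 expectation_law_1
    by (simp add: factorial_moment_eq_pderiv_pgf expectation_eq_pderiv_pgf flip: pgf_eq_power
        del: One_nat_def)
  then show ?thesis
    by (subst measure_pmf.variance_eq) (simp_all add: mean_law algebra_simps power2_eq_square)
qed

section \<open>Realisation as a sum of independent variables, and the central limit theorem\<close>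

lemma char_law:
  "char (distr (law n) borel real) t = char (distr (law 1) borel real) t ^ n"
proof -
  \<comment> \<open>A complex copy of \<open>pgf n\<close>, since the characteristic function at
    \<open>t\<close> is the generating function at \<open>iexp t\<close>.\<close>
  define G where "G n = (\<Sum>k\<le>s * n. monom (complex_of_real (pmf (law n) k)) k)" for n
  have char: "char (distr (law n) borel real) t = poly (G n) (iexp t)" for n
    by (simp add: char_def integral_distr expectation_law G_def poly_sum poly_monom
        scaleR_conv_of_real mult_ac flip: exp_of_nat_mult)
  have "poly (G n) (of_real x) = of_real (poly (pgf n) x)" for n x
    by (simp add: G_def pgf_def poly_sum poly_monom)
  then have "G n = G 1 ^ n"
    by (intro complex_poly_eqI_of_real) (metis of_real_power pgf_eq_power poly_power)
  then show ?thesis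
    by (simp add: char)
qed

text \<open>One infinite product serves all \<open>n\<close> at once: the central limit theorem
  speaks of a single sequence of variables on a fixed space.\<close>

definition iid_space :: "(nat \<Rightarrow> nat) measure" where
  "iid_space = (\<Pi>\<^sub>M i\<in>UNIV. measure_pmf (law 1))"

sublocale iid: prob_space iid_space
  unfolding iid_space_def by (intro prob_space_PiM measure_pmf.prob_space_axioms)

lemma measurable_iid_component [measurable]:
  "(\<lambda>\<omega>. \<omega> i) \<in> measurable iid_space (count_space UNIV)"
  unfolding iid_space_def by measurable

lemma distr_iid_component: "distr iid_space (count_space UNIV) (\<lambda>\<omega>. \<omega> i) = measure_pmf (law 1)"
proof -
  have "distr iid_space (count_space UNIV) (\<lambda>\<omega>. \<omega> i) =
      distr iid_space (measure_pmf (law 1)) (\<lambda>\<omega>. \<omega> i)"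
    by (rule distr_cong) simp_all
  also have "\<dots> = measure_pmf (law 1)"
    unfolding iid_space_def
    by (rule distr_PiM_component) (simp_all add: measure_pmf.prob_space_axioms)
  finally show ?thesis .
qed

lemma indep_iid: "iid.indep_vars (\<lambda>_. borel) (\<lambda>i \<omega>. real (\<omega> i)) UNIV"
proof -
  have "iid.indep_vars (\<lambda>_. count_space UNIV) (\<lambda>i \<omega>. \<omega> i) UNIV"
  proof (subst iid.indep_vars_iff_distr_eq_PiM')
    \<comment> \<open>The joint map of all coordinates is the identity, so their joint law is the
      product measure itself; only the sigma-algebras have to be matched.\<close>
    have "distr iid_space (\<Pi>\<^sub>M i\<in>UNIV. count_space UNIV) (\<lambda>x. \<lambda>i\<in>UNIV. x i) =
        distr iid_space iid_space (\<lambda>x. x)"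
      unfolding iid_space_def by (intro distr_cong refl sets_PiM_cong) auto
    then show "distr iid_space (\<Pi>\<^sub>M i\<in>UNIV. count_space UNIV) (\<lambda>x. \<lambda>i\<in>UNIV. x i) =
        (\<Pi>\<^sub>M i\<in>UNIV. distr iid_space (count_space UNIV) (\<lambda>\<omega>. \<omega> i))"
      by (simp add: distr_iid_component) (simp add: iid_space_def)
  qed simp_all
  then show ?thesis
    by (rule iid.indep_vars_compose2) simp
qed

lemma distr_real_iid_component: "distr iid_space borel (\<lambda>\<omega>. real (\<omega> i)) = distr (law 1) borel real"
  unfolding distr_iid_component[of i, symmetric] by (subst distr_distr) (auto simp: comp_def)

text \<open>Independence makes the characteristic function of the sum an \<open>n\<close>-fold
  product, \<open>char_law\<close> recognises it, and Levy's uniqueness theorem identifies the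
  laws.\<close>

lemma distr_sum_iid: "distr iid_space borel (\<lambda>\<omega>. \<Sum>i<n. real (\<omega> i)) = distr (law n) borel real"
proof (rule Levy_uniqueness)
  show "real_distribution (distr iid_space borel (\<lambda>\<omega>. \<Sum>i<n. real (\<omega> i)))"
    by (rule iid.real_distribution_distr) simp
  show "real_distribution (distr (law n) borel real)"
    by (rule prob_space.real_distribution_distr[OF measure_pmf.prob_space_axioms]) simp
  have "char (distr iid_space borel (\<lambda>\<omega>. \<Sum>i<n. real (\<omega> i))) t =
      (\<Prod>i<n. char (distr iid_space borel (\<lambda>\<omega>. real (\<omega> i))) t)" for t
    by (rule iid.char_distr_sum, rule iid.indep_vars_subset[OF indep_iid]) simp
  then show "char (distr iid_space borel (\<lambda>\<omega>. \<Sum>i<n. real (\<omega> i))) =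
      char (distr (law n) borel real)"
    by (simp add: fun_eq_iff distr_real_iid_component char_law[of n])
qed

lemma central_limit_law:
  "weak_conv_m (\<lambda>n. distr (law n) borel (\<lambda>k. (real k - real n * m) / sqrt (real n * v)))
     std_normal_distribution"
proof -
  have integ: "integrable iid_space (\<lambda>\<omega>. f (\<omega> i))" for f :: "nat \<Rightarrow> real" and i
    using integrable_law[of 1 f] unfolding distr_iid_component[of i, symmetric]
    by (simp add: integrable_distr_eq)
  have integral: "iid.expectation (\<lambda>\<omega>. f (\<omega> i)) = measure_pmf.expectation (law 1) f"
    for f :: "nat \<Rightarrow> real" and i
    unfolding distr_iid_component[of i, symmetric] by (simp add: integral_distr)
  \<comment> \<open>The variance is written \<open>(sqrt v)\<^sup>2\<close> to match
    \<open>central_limit_theorem\<close>, which is phrased with the standard deviation.\<close>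
  have "weak_conv_m (\<lambda>n. distr iid_space borel
      (\<lambda>\<omega>. (\<Sum>i<n. real (\<omega> i) - m) / sqrt (real n * (sqrt v)\<^sup>2))) std_normal_distribution"
  proof (rule iid.central_limit_theorem[where \<mu> = "distr (law 1) borel real"])
    show "iid.variance (\<lambda>\<omega>. real (\<omega> i)) = (sqrt v)\<^sup>2" for i
      using v_pos variance_law[of 1] integral[of "\<lambda>k. (real k - m)\<^sup>2" i] integral[of real i]
      by (simp add: expectation_law_1 del: One_nat_def)
  qed (use v_pos in \<open>simp_all del: One_nat_def add: indep_iid integ[of "\<lambda>k. (real k)\<^sup>2"] distr_real_iid_component
        integral[of real] expectation_law_1\<close>)
  moreover have "distr (law n) borel (\<lambda>k. (real k - real n * m) / sqrt (real n * v)) =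
      distr iid_space borel (\<lambda>\<omega>. (\<Sum>i<n. real (\<omega> i) - m) / sqrt (real n * (sqrt v)\<^sup>2))" for n
  proof -
    \<comment> \<open>The normalisation is affine in the sum, and the \<open>n\<close> centred terms
      add up to the sum minus \<open>n * m\<close>.\<close>
    let ?h = "\<lambda>x. (x - real n * m) / sqrt (real n * v)"
    have "distr (law n) borel (\<lambda>k. ?h (real k)) = distr (distr (law n) borel real) borel ?h"
      by (subst distr_distr) (auto simp: comp_def)
    also have "\<dots> = distr iid_space borel (\<lambda>\<omega>. ?h (\<Sum>i<n. real (\<omega> i)))"
      unfolding distr_sum_iid[symmetric] by (subst distr_distr) (auto simp: comp_def)
    finally show ?thesis
      using v_pos by (simp add: sum_subtractf)
  qed
  ultimately show ?thesis
    by simp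
qed

end

section \<open>Transfer from the law to arbitrary variables that have it\<close>

theorem theorem6p1:
  fixes s :: nat and p q :: real
    and M :: "nat \<Rightarrow> 'a measure" and X :: "nat \<Rightarrow> 'a \<Rightarrow> nat"
    and \<mu> \<sigma>2 :: "nat \<Rightarrow> real"
  assumes "s \<ge> 1" and "0 < p" "p < 1" and "0 < q" "q < 1" and "p \<noteq> q"
    and "(\<Sum>k=0..s. p ^ k * q ^ (s - k)) = 1"
    and "\<And>n. n \<ge> 1 \<Longrightarrow> prob_space (M n)"
    and "\<And>n. n \<ge> 1 \<Longrightarrow> X n \<in> measurable (M n) (count_space UNIV)"
    and "\<And>n. n \<ge> 1 \<Longrightarrow>
           distr (M n) (count_space UNIV) (X n) = measure_pmf (bisnomial_pmf s n p q)"
  defines "\<mu> \<equiv> \<lambda>n. real n * p * (((real s + 1) * p ^ s - 1) / (p - q))"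
    and "\<sigma>2 \<equiv> \<lambda>n. real n * p * q * ((1 - (real s + 1)\<^sup>2 * (p * q) ^ s) / (p - q)\<^sup>2)"
  shows "(\<forall>n\<ge>1. prob_space.expectation (M n) (\<lambda>\<omega>. real (X n \<omega>)) = \<mu> n \<and>
                 prob_space.variance (M n) (\<lambda>\<omega>. real (X n \<omega>)) = \<sigma>2 n) \<and>
         weak_conv_m (\<lambda>n. distr (M n) borel (\<lambda>\<omega>. (real (X n \<omega>) - \<mu> n) / sqrt (\<sigma>2 n)))
           std_normal_distribution"
proof -
  interpret bisnomial_params s p q
    using assms by unfold_locales auto
  note X [measurable] = assms(9)
  have \<mu>: "\<mu> n = real n * m" and \<sigma>2: "\<sigma>2 n = real n * v" for n
    by (simp_all add: \<mu>_def \<sigma>2_def m_def v_def)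
  have integral: "(\<integral>\<omega>. f (X n \<omega>) \<partial>M n) = measure_pmf.expectation (law n) f"
    if "n \<ge> 1" for f :: "nat \<Rightarrow> real" and n
    using X[OF that] by (simp add: integral_distr flip: assms(10)[OF that])
  have "distr (M n) borel (\<lambda>\<omega>. (real (X n \<omega>) - \<mu> n) / sqrt (\<sigma>2 n)) =
      distr (law n) borel (\<lambda>k. (real k - real n * m) / sqrt (real n * v))" if "n \<ge> 1" for n
    unfolding assms(10)[OF that, symmetric] \<mu> \<sigma>2
    using X[OF that] by (subst distr_distr) (auto simp: comp_def)
  \<comment> \<open>Nothing is known about \<open>M 0\<close>, so the two sequences of laws are
    compared only from index 1 on.\<close>
  then have "weak_conv_m (\<lambda>n. distr (M n) borel (\<lambda>\<omega>. (real (X n \<omega>) - \<mu> n) / sqrt (\<sigma>2 n)))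
      std_normal_distribution"
    using central_limit_law
    by (subst weak_conv_m_cong) (auto simp: eventually_sequentially)
  moreover have "(\<integral>\<omega>. real (X n \<omega>) \<partial>M n) = \<mu> n" if "n \<ge> 1" for n
    using integral[OF that, of real] by (simp add: mean_law \<mu>)
  moreover have "(\<integral>\<omega>. (real (X n \<omega>) - \<mu> n)\<^sup>2 \<partial>M n) = \<sigma>2 n" if "n \<ge> 1" for n
    using integral[OF that, of "\<lambda>k. (real k - \<mu> n)\<^sup>2"] variance_law[of n]
    by (simp add: mean_law \<mu> \<sigma>2)
  ultimately show ?thesis
    by auto
qed

end
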